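(* Let $(X,Y)$ be independent random variables over finite sets $\mathcal{X}\times\mathcal{Y}$, and let $f:\mathcal{X}\times\mathcal{Y}\to\{0,1\}$ satisfy $\mathrm{Disc}_{XY}(f)\le\Delta$, where $\Delta>0$. Let $Z$ be a binary random variable jointly distributed with $(X,Y)$ such that $\Pr[Z\ne f(X,Y)]\le \frac12-\epsilon$, where $\epsilon>0$. Then \[ T_{\mathrm{Wyn}}(X,Z;Y,Z) \ge \frac{\epsilon}{2(1-\epsilon)}\log\frac{\epsilon}{\Delta} - 4. \]
   Context: The discrepancy of $f$ with respect to the distribution $p_{XY}$ is $\mathrm{Disc}_{XY}(f)=\max_{\mathcal{X}'\subseteq\mathcal{X},\,\mathcal{Y}'\subseteq\mathcal{Y}}\big|\Pr[(X,Y)\in\mathcal{X}'\times\mathcal{Y}',\,f(X,Y)=0]-\Pr[(X,Y)\in\mathcal{X}'\times\mathcal{Y}',\,f(X,Y)=1]\big|$. For jointly distributed $(U,V)$, the Wyner tension is $T_{\mathrm{Wyn}}(U;V)=\inf_{p_{Q|UV}:\ I(U;V|Q)=0}\big(I(U;Q|V)+I(V;Q|U)\big)$; $T_{\mathrm{Wyn}}(X,Z;Y,Z)$ is this with $U=(X,Z)$, $V=(Y,Z)$. Logarithms are base 2. *)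

theory Defs
  imports "HOL-Probability.Probability"
begin

definition discrepancy :: "('x::finite \<times> 'y::finite) pmf \<Rightarrow> ('x \<Rightarrow> 'y \<Rightarrow> bool) \<Rightarrow> real" where
  "discrepancy p f =
     Max {\<bar>measure_pmf.prob p {(x, y). (x, y) \<in> A \<times> B \<and> \<not> f x y}
           - measure_pmf.prob p {(x, y). (x, y) \<in> A \<times> B \<and> f x y}\<bar> | A B. True}"

text \<open>Logarithms are to base 2. For countable ranges the product of counting spaces is again a
  counting space, so this is \<open>I(A;B|C)\<close> for discrete variables; the library defines it as
  \<open>I(A;(B,C)) - I(A;C)\<close>, and both terms are finite when \<open>A\<close> takes finitely many values.\<close>

definition cond_mi ::
  "'w pmf \<Rightarrow> ('w \<Rightarrow> 'a::finite) \<Rightarrow> ('w \<Rightarrow> 'b::countable) \<Rightarrow> ('w \<Rightarrow> 'c::countable) \<Rightarrow> real" where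
  "cond_mi p A B C =
     prob_space.conditional_mutual_information (measure_pmf p) 2
       (count_space UNIV) (count_space UNIV) (count_space UNIV) A B C"

text \<open>The law of \<open>(U, V, Q)\<close> when \<open>(U, V)\<close> has law \<open>r\<close> and \<open>K\<close> is the conditional
  distribution of \<open>Q\<close> given \<open>(U, V)\<close>.\<close>

definition extend_law :: "('u \<times> 'v) pmf \<Rightarrow> ('u \<times> 'v \<Rightarrow> nat pmf) \<Rightarrow> ('u \<times> 'v \<times> nat) pmf" where
  "extend_law r K =
     bind_pmf r (\<lambda>(u, v). map_pmf (\<lambda>q. (u, v, q)) (K (u, v)))"

text \<open>\<open>Q\<close> ranges over all discrete variables, encoded in \<^typ>\<open>nat\<close>. The set below is nonempty,
  since \<open>Q\<close> may encode \<open>(U, V)\<close>, and consists of nonnegative reals, so the real infimum is the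
  intended one.\<close>

definition wyner_tension :: "('u::finite \<times> 'v::finite) pmf \<Rightarrow> real" where
  "wyner_tension r =
     (let U = (\<lambda>(u, v, q). u); V = (\<lambda>(u, v, q). v); Q = (\<lambda>(u, v, q). q)
      in Inf {cond_mi (extend_law r K) U Q V + cond_mi (extend_law r K) V Q U | K.
                cond_mi (extend_law r K) U V Q = 0})"

end

theory Submission
  imports Defs
begin

text \<open>Since \<open>Z\<close> is a component of both \<open>U = (X,Z)\<close> and \<open>V = (Y,Z)\<close>, the condition \<open>I(U;V|Q) = 0\<close> makes
  \<open>Z\<close> a function of \<open>Q\<close> and makes \<open>X\<close>, \<open>Y\<close> independent given \<open>Q\<close>. As \<open>X\<close>, \<open>Y\<close> are also independent
  unconditionally, the tension equals \<open>I(X;Q) + I(Y;Q) + 2 H(Z|X,Y) - H(Z|X) - H(Z|Y)\<close>, which is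
  at least \<open>I(X;Q) + I(Y;Q) - 2\<close>. Where both information densities \<open>log (p(x|q)/p(x))\<close> and
  \<open>log (p(y|q)/p(y))\<close> are at most \<open>\<tau>\<close>, the law given \<open>Q\<close> has product weights bounded by
  \<open>2\<^sup>\<tau>\<close> times the marginals, so there \<open>Z\<close> predicts \<open>f\<close> with advantage at most \<open>4\<^sup>\<tau> \<Delta>\<close>. Hence the
  larger density exceeds \<open>\<tau>\<close> with probability at least \<open>2\<epsilon> - 4\<^sup>\<tau> \<Delta>\<close>, and summing over the
  thresholds \<open>\<tau> = k/4\<close> bounds the positive parts of the densities below by
  \<open>\<epsilon> log (\<epsilon>/\<Delta>) - 5\<epsilon>/4\<close>. The negative parts cost at most 3/5 each.\<close>

subsection \<open>Conditional entropy\<close>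

text \<open>The probability of the observed value, as a random variable on the sample space;
  information quantities then become expectations over \<open>P\<close> itself.\<close>

definition prob_at :: "'w pmf \<Rightarrow> ('w \<Rightarrow> 'a) \<Rightarrow> 'w \<Rightarrow> real" where
  "prob_at P A w = pmf (map_pmf A P) (A w)"

text \<open>The quotient is the reciprocal of the conditional probability of \<open>A\<close> given
  \<open>B\<close>, so the integrand is nonnegative on the support.\<close>

definition cond_entropy :: "'w pmf \<Rightarrow> ('w \<Rightarrow> 'a) \<Rightarrow> ('w \<Rightarrow> 'b) \<Rightarrow> real" where
  "cond_entropy P A B =
     measure_pmf.expectation P (\<lambda>w. log 2 (prob_at P B w / prob_at P (\<lambda>w. (A w, B w)) w))"

lemma prob_at_eq_prob: "prob_at P A w = measure_pmf.prob P {w'. A w' = A w}"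
  by (simp add: prob_at_def pmf_map vimage_def)

lemma prob_at_pos: "w \<in> set_pmf P \<Longrightarrow> prob_at P A w > 0"
  by (simp add: prob_at_def pmf_positive)

lemma prob_at_mono:
  assumes "\<And>w'. w' \<in> set_pmf P \<Longrightarrow> A w' = A w \<Longrightarrow> B w' = B w"
  shows "prob_at P A w \<le> prob_at P B w"
  unfolding prob_at_eq_prob
  by (rule measure_pmf.finite_measure_mono_AE) (auto simp: AE_measure_pmf_iff assms)

lemma prob_at_cong:
  assumes "\<And>w'. w' \<in> set_pmf P \<Longrightarrow> A w' = A w \<longleftrightarrow> B w' = B w"
  shows "prob_at P A w = prob_at P B w"
  using assms by (intro antisym prob_at_mono) auto

text \<open>The mass of \<open>r\<close> cancels against the denominator and leaves the mass of
  \<open>s\<close> on the support of \<open>r\<close>; its finiteness gives integrability.\<close>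

lemma expectation_pmf_ratio:
  fixes r s :: "'a pmf"
  shows "integrable (measure_pmf r) (\<lambda>x. pmf s x / pmf r x)"
    and "measure_pmf.expectation r (\<lambda>x. pmf s x / pmf r x) = measure_pmf.prob s (set_pmf r)"
proof -
  have nn: "(\<integral>\<^sup>+x. ennreal (pmf s x / pmf r x) \<partial>measure_pmf r) = emeasure (measure_pmf s) (set_pmf r)"
  proof -
    have "(\<integral>\<^sup>+x. ennreal (pmf s x / pmf r x) \<partial>measure_pmf r)
        = (\<integral>\<^sup>+x. ennreal (pmf s x) * indicator (set_pmf r) x \<partial>count_space UNIV)"
      unfolding nn_integral_measure_pmf
      by (intro nn_integral_cong)
        (auto simp: indicator_def set_pmf_iff ennreal_mult[symmetric] simp del: ennreal_mult'')
    also have "\<dots> = (\<integral>\<^sup>+x. indicator (set_pmf r) x \<partial>measure_pmf s)"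
      unfolding nn_integral_measure_pmf ..
    also have "\<dots> = emeasure (measure_pmf s) (set_pmf r)"
      by simp
    finally show ?thesis .
  qed
  show "integrable (measure_pmf r) (\<lambda>x. pmf s x / pmf r x)"
    by (rule integrableI_nonneg) (auto simp: nn measure_pmf.emeasure_eq_measure)
  show "measure_pmf.expectation r (\<lambda>x. pmf s x / pmf r x) = measure_pmf.prob s (set_pmf r)"
    by (subst integral_eq_nn_integral) (auto simp: nn measure_def)
qed

lemma expectation_prob_at_ratio:
  fixes P :: "'w pmf" and s :: "'a pmf"
  shows "integrable (measure_pmf P) (\<lambda>w. pmf s (C w) / prob_at P C w)"
    and "measure_pmf.expectation P (\<lambda>w. pmf s (C w) / prob_at P C w) \<le> 1"
  using expectation_pmf_ratio[of "map_pmf C P" s]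
  by (simp_all add: prob_at_def)

text \<open>Up to the factor \<open>CARD('a)\<close>, the reciprocal conditional probability is the
  likelihood ratio of the uniform law times the law of \<open>B\<close> against the joint
  law.\<close>

lemma expectation_cond_prob_inverse:
  fixes P :: "'w pmf" and A :: "'w \<Rightarrow> 'a::finite"
  shows "integrable (measure_pmf P) (\<lambda>w. prob_at P B w / prob_at P (\<lambda>w. (A w, B w)) w)"
    and "measure_pmf.expectation P (\<lambda>w. prob_at P B w / prob_at P (\<lambda>w. (A w, B w)) w)
           \<le> CARD('a)"
proof -
  let ?s = "pair_pmf (pmf_of_set (UNIV :: 'a set)) (map_pmf B P)"
  have *: "prob_at P B w / prob_at P (\<lambda>w. (A w, B w)) w
    = CARD('a) * (pmf ?s (A w, B w) / prob_at P (\<lambda>w. (A w, B w)) w)" for w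
    by (simp add: pmf_pair prob_at_def)
  show "integrable (measure_pmf P) (\<lambda>w. prob_at P B w / prob_at P (\<lambda>w. (A w, B w)) w)"
    unfolding * by (intro integrable_mult_right expectation_prob_at_ratio)
  show "measure_pmf.expectation P (\<lambda>w. prob_at P B w / prob_at P (\<lambda>w. (A w, B w)) w)
           \<le> CARD('a)"
    unfolding * integral_mult_right_zero
    using mult_left_mono[OF expectation_prob_at_ratio(2)[of P ?s "\<lambda>w. (A w, B w)"], of "CARD('a)"]
    by simp
qed

text \<open>\<open>B\<close> may have infinite range, so integrability is not automatic. The
  quotient is at least 1, where its logarithm is dominated by the quotient over \<open>ln 2\<close>,
  and that is integrable because \<open>A\<close> has finite range.\<close>

lemma integrable_cond_entropy:
  fixes P :: "'w pmf" and A :: "'w \<Rightarrow> 'a::finite"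
  shows "integrable (measure_pmf P) (\<lambda>w. log 2 (prob_at P B w / prob_at P (\<lambda>w. (A w, B w)) w))"
proof (rule Bochner_Integration.integrable_bound)
  let ?r = "\<lambda>w. prob_at P B w / prob_at P (\<lambda>w. (A w, B w)) w"
  show "integrable (measure_pmf P) (\<lambda>w. ?r w / ln 2)"
    by (intro integrable_divide_zero impI expectation_cond_prob_inverse)
  show "AE w in measure_pmf P. norm (log 2 (?r w)) \<le> norm (?r w / ln 2)"
  proof (rule AE_pmfI)
    fix w assume w: "w \<in> set_pmf P"
    have "prob_at P (\<lambda>w. (A w, B w)) w \<le> prob_at P B w"
      by (rule prob_at_mono) simp
    with prob_at_pos[OF w, of "\<lambda>w. (A w, B w)"] have "1 \<le> ?r w"
      by (simp add: le_divide_eq_1_pos)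
    moreover have "norm (log 2 t) \<le> norm (t / ln 2)" if "1 \<le> t" for t :: real
      using that ln_le_minus_one[of t] by (simp add: log_def divide_right_mono)
    ultimately show "norm (log 2 (?r w)) \<le> norm (?r w / ln 2)"
      by blast
  qed
qed simp

lemma integrable_finite_range:
  fixes P :: "'w pmf" and A :: "'w \<Rightarrow> 'a::finite" and g :: "'a \<Rightarrow> real"
  shows "integrable (measure_pmf P) (\<lambda>w. g (A w))"
  by (rule measure_pmf.integrable_const_bound[where B="Max (range (\<lambda>a. norm (g a)))"]) auto

text \<open>Point masses are densities with respect to counting measure, so the density formula for
  mutual information turns into an expectation under the joint law.\<close>

lemma mutual_information_eq_expectation:
  fixes P :: "'w pmf" and A :: "'w \<Rightarrow> 'a::countable" and B :: "'w \<Rightarrow> 'b::countable"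
  shows "prob_space.mutual_information (measure_pmf P) 2 (count_space UNIV) (count_space UNIV) A B
    = measure_pmf.expectation P
        (\<lambda>w. log 2 (prob_at P (\<lambda>w. (A w, B w)) w / (prob_at P A w * prob_at P B w)))"
proof -
  interpret information_space "measure_pmf P" 2
    by (simp add: information_space_def information_space_axioms_def measure_pmf.prob_space_axioms)
  have dist: "distributed (measure_pmf P) (count_space UNIV) C (\<lambda>c. ennreal (pmf (map_pmf C P) c))"
    for C :: "'w \<Rightarrow> 'd"
    by (simp add: distributed_def measure_pmf_eq_density[symmetric] map_pmf_rep_eq[symmetric])
  have prod: "count_space (UNIV :: 'a set) \<Otimes>\<^sub>M count_space (UNIV :: 'b set) = count_space UNIV"
    by (simp add: pair_measure_countable)
  let ?g = "\<lambda>x. log 2 (pmf (map_pmf (\<lambda>w. (A w, B w)) P) x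
                  / (pmf (map_pmf A P) (fst x) * pmf (map_pmf B P) (snd x)))"
  have "prob_space.mutual_information (measure_pmf P) 2 (count_space UNIV) (count_space UNIV) A B
    = (\<integral>x. pmf (map_pmf (\<lambda>w. (A w, B w)) P) x * ?g x \<partial>count_space UNIV)"
    by (subst mutual_information_distr[OF _ _ dist _ dist])
      (simp_all add: prod sigma_finite_measure_count_space dist)
  also have "\<dots> = measure_pmf.expectation (map_pmf (\<lambda>w. (A w, B w)) P) ?g"
    unfolding measure_pmf_eq_density by (simp add: integral_density)
  finally show ?thesis
    by (simp add: prob_at_def)
qed

lemma mutual_information_eq_cond_entropy:
  fixes P :: "'w pmf" and A :: "'w \<Rightarrow> 'a::finite" and B :: "'w \<Rightarrow> 'b::countable"
  shows "prob_space.mutual_information (measure_pmf P) 2 (count_space UNIV) (count_space UNIV) A B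
    = measure_pmf.expectation P (\<lambda>w. log 2 (1 / prob_at P A w)) - cond_entropy P A B"
proof -
  have "measure_pmf.expectation P
          (\<lambda>w. log 2 (prob_at P (\<lambda>w. (A w, B w)) w / (prob_at P A w * prob_at P B w)))
      = measure_pmf.expectation P (\<lambda>w. log 2 (1 / prob_at P A w)
          - log 2 (prob_at P B w / prob_at P (\<lambda>w. (A w, B w)) w))"
  proof (rule integral_cong_AE)
    show "AE w in measure_pmf P.
        log 2 (prob_at P (\<lambda>w. (A w, B w)) w / (prob_at P A w * prob_at P B w))
      = log 2 (1 / prob_at P A w) - log 2 (prob_at P B w / prob_at P (\<lambda>w. (A w, B w)) w)"
    proof (rule AE_pmfI)
      fix w assume "w \<in> set_pmf P"
      note pos = prob_at_pos[OF this]
      show "log 2 (prob_at P (\<lambda>w. (A w, B w)) w / (prob_at P A w * prob_at P B w))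
          = log 2 (1 / prob_at P A w) - log 2 (prob_at P B w / prob_at P (\<lambda>w. (A w, B w)) w)"
        using pos[of A] pos[of B] pos[of "\<lambda>w. (A w, B w)"] by (simp add: log_divide log_mult)
    qed
  qed simp_all
  also have "\<dots> = measure_pmf.expectation P (\<lambda>w. log 2 (1 / prob_at P A w)) - cond_entropy P A B"
    unfolding cond_entropy_def
    by (rule Bochner_Integration.integral_diff[OF _ integrable_cond_entropy])
      (simp add: prob_at_def integrable_finite_range[of P "\<lambda>a. log 2 (1 / pmf (map_pmf A P) a)"])
  finally show ?thesis
    by (simp add: mutual_information_eq_expectation)
qed

text \<open>In \<open>I(A;(B,C)) - I(A;C)\<close> the entropy of \<open>A\<close> cancels.\<close>

lemma cond_mi_eq_cond_entropy:
  "cond_mi P A B C = cond_entropy P A C - cond_entropy P A (\<lambda>w. (B w, C w))"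
  unfolding cond_mi_def prob_space.conditional_mutual_information_def[OF measure_pmf.prob_space_axioms]
  by (simp add: pair_measure_countable mutual_information_eq_cond_entropy)

text \<open>Jensen's inequality by hand: the logarithm lies below its tangent at
  \<open>CARD('a)\<close>, and the reciprocal conditional probability has mean at most
  \<open>CARD('a)\<close>.\<close>

lemma cond_entropy_le_log_card:
  fixes P :: "'w pmf" and A :: "'w \<Rightarrow> 'a::finite"
  shows "cond_entropy P A B \<le> log 2 (CARD('a))"
proof -
  let ?r = "\<lambda>w. prob_at P B w / prob_at P (\<lambda>w. (A w, B w)) w"
  let ?n = "real CARD('a)"
  have "cond_entropy P A B \<le> measure_pmf.expectation P (\<lambda>w. log 2 ?n + (?r w / ?n - 1) / ln 2)"
    unfolding cond_entropy_def
  proof (rule integral_mono_AE)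
    show "integrable (measure_pmf P) (\<lambda>w. log 2 ?n + (?r w / ?n - 1) / ln 2)"
      by (intro Bochner_Integration.integrable_add Bochner_Integration.integrable_diff
        integrable_divide_zero impI expectation_cond_prob_inverse) simp_all
    show "AE w in measure_pmf P. log 2 (?r w) \<le> log 2 ?n + (?r w / ?n - 1) / ln 2"
    proof (rule AE_pmfI)
      fix w assume "w \<in> set_pmf P"
      then have "0 < ?r w" by (simp add: prob_at_pos)
      then have r: "0 < ?r w / ?n" by (rule divide_pos_pos) simp
      have "ln (?r w / ?n) = ln (?r w) - ln ?n"
        by (intro ln_divide_pos \<open>0 < ?r w\<close>) simp_all
      then have "log 2 (?r w) = log 2 ?n + ln (?r w / ?n) / ln 2"
        by (simp only: log_def diff_divide_distrib)
      also have "\<dots> \<le> log 2 ?n + (?r w / ?n - 1) / ln 2"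
        using ln_le_minus_one[OF r] by (simp add: divide_right_mono)
      finally show "log 2 (?r w) \<le> log 2 ?n + (?r w / ?n - 1) / ln 2" .
    qed
  qed (rule integrable_cond_entropy)
  also have "\<dots> = log 2 ?n + (measure_pmf.expectation P ?r / ?n - 1) / ln 2"
    by (simp add: expectation_cond_prob_inverse del: divide_divide_eq_left)
  also have "\<dots> \<le> log 2 ?n"
    using expectation_cond_prob_inverse(2)[of P B A] by (simp add: divide_nonpos_pos)
  finally show ?thesis .
qed

subsection \<open>Conditional independence\<close>

text \<open>Equality case of Gibbs' inequality. With \<open>t\<close> the ratio of \<open>s\<close>
  to \<open>r\<close>, the function \<open>t - 1 - ln t\<close> is nonnegative and vanishes only at
  1, while zero relative entropy makes its expectation nonpositive.\<close>

lemma gibbs_equality: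
  fixes r s :: "'a pmf"
  assumes pos: "\<And>x. x \<in> set_pmf r \<Longrightarrow> 0 < pmf s x"
    and int: "integrable (measure_pmf r) (\<lambda>x. log 2 (pmf r x / pmf s x))"
    and zero: "measure_pmf.expectation r (\<lambda>x. log 2 (pmf r x / pmf s x)) = 0"
  shows "r = s"
proof -
  let ?t = "\<lambda>x. pmf s x / pmf r x"
  let ?l = "\<lambda>x. log 2 (pmf r x / pmf s x)"
  let ?d = "\<lambda>x. ?t x - 1 + ln 2 * ?l x"
  have d: "?d x = ?t x - 1 - ln (?t x)" if "x \<in> set_pmf r" for x
    using pos[OF that] pmf_positive[OF that] by (simp add: log_def ln_div)
  have d_nonneg: "0 \<le> ?d x" if "x \<in> set_pmf r" for x
    using ln_le_minus_one[of "?t x"] pos[OF that] pmf_positive[OF that] unfolding d[OF that] by simp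
  have int_d: "integrable (measure_pmf r) ?d"
    by (intro Bochner_Integration.integrable_add Bochner_Integration.integrable_diff
        expectation_pmf_ratio integrable_mult_right int) simp_all
  have E_d: "measure_pmf.expectation r ?d = measure_pmf.prob s (set_pmf r) - 1"
    by (simp add: expectation_pmf_ratio int zero)
  have "measure_pmf.expectation r ?d = 0"
  proof (rule antisym)
    show "measure_pmf.expectation r ?d \<le> 0"
      unfolding E_d by simp
    show "0 \<le> measure_pmf.expectation r ?d"
      by (rule integral_nonneg_AE, rule AE_pmfI, rule d_nonneg)
  qed
  then have "AE x in measure_pmf r. ?d x = 0"
    using integral_nonneg_eq_0_iff_AE[OF int_d AE_pmfI[OF d_nonneg]] by blast
  then have "?d x = 0" if "x \<in> set_pmf r" for x
    using that by (simp add: AE_measure_pmf_iff)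
  then have eq: "pmf s x = pmf r x" if "x \<in> set_pmf r" for x
    using that pos[OF that] pmf_positive[OF that] ln_eq_minus_one[of "?t x"] d[OF that] by simp
  \<comment> \<open>Agreement on the support of \<open>r\<close> says nothing about mass of
    \<open>s\<close> elsewhere; the vanishing expectation rules such mass out.\<close>
  have "measure_pmf.prob s (set_pmf r) = 1"
    using E_d \<open>measure_pmf.expectation r ?d = 0\<close> by simp
  then have "set_pmf s \<subseteq> set_pmf r"
    by (subst (asm) measure_pmf.prob_eq_1) (auto simp: AE_measure_pmf_iff)
  then show "r = s"
    by (intro pmf_eqI) (metis eq pmf_eq_0_set_pmf subsetD)
qed

lemma measure_cond_pmf:
  assumes "set_pmf p \<inter> S \<noteq> {}"
  shows "measure_pmf.prob (cond_pmf p S) A = measure_pmf.prob p (S \<inter> A) / measure_pmf.prob p S"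
proof -
  have "emeasure (measure_pmf p) S \<noteq> 0"
    using assms by (rule emeasure_measure_pmf_not_zero)
  then show ?thesis
    by (simp add: cond_pmf.rep_eq[OF assms] measure_uniform_measure)
qed

text \<open>Keeps the joint laws of \<open>(U, Q)\<close> and of \<open>(V, Q)\<close>, but makes \<open>U\<close> and \<open>V\<close> independent given \<open>Q\<close>.\<close>

definition cond_product ::
  "'w pmf \<Rightarrow> ('w \<Rightarrow> 'a) \<Rightarrow> ('w \<Rightarrow> 'b) \<Rightarrow> ('w \<Rightarrow> 'c) \<Rightarrow> ('a \<times> 'b \<times> 'c) pmf" where
  "cond_product P U V Q = bind_pmf P (\<lambda>w.
     let c = cond_pmf P {w'. Q w' = Q w}
     in map_pmf (\<lambda>(u, v). (u, v, Q w)) (pair_pmf (map_pmf U c) (map_pmf V c)))"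

text \<open>Used to drop the component \<open>Z\<close> from both sides while keeping conditional
  independence.\<close>

lemma map_cond_product:
  "map_pmf (\<lambda>(u, v, q). (g u, h v, q)) (cond_product P U V Q)
     = cond_product P (\<lambda>w. g (U w)) (\<lambda>w. h (V w)) Q"
proof -
  have "pair_pmf (map_pmf (\<lambda>w. g (U w)) c) (map_pmf (\<lambda>w. h (V w)) c)
     = map_pmf (\<lambda>(u, v). (g u, h v)) (pair_pmf (map_pmf U c) (map_pmf V c))" for c
    by (simp add: map_pair pmf.map_comp comp_def)
  then show ?thesis
    by (simp add: cond_product_def map_bind_pmf Let_def pmf.map_comp comp_def case_prod_unfold)
qed

text \<open>Only outcomes with \<open>Q w = q\<close> contribute to the mixture, and all of them
  contribute the same product. If \<open>q\<close> has probability 0, both sides are 0, the right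
  one by division by zero.\<close>

lemma pmf_cond_product:
  "pmf (cond_product P U V Q) (u, v, q)
     = measure_pmf.prob P {w. U w = u \<and> Q w = q} * measure_pmf.prob P {w. V w = v \<and> Q w = q}
         / measure_pmf.prob P {w. Q w = q}"
proof -
  let ?pq = "measure_pmf.prob P {w. Q w = q}"
  let ?a = "measure_pmf.prob P {w. U w = u \<and> Q w = q} / ?pq"
  let ?b = "measure_pmf.prob P {w. V w = v \<and> Q w = q} / ?pq"
  let ?m = "\<lambda>w. let c = cond_pmf P {w'. Q w' = Q w}
     in map_pmf (\<lambda>(u, v). (u, v, Q w)) (pair_pmf (map_pmf U c) (map_pmf V c))"
  have eq: "pmf (?m w) (u, v, q) = indicator {w. Q w = q} w * (?a * ?b)" if w: "w \<in> set_pmf P" for w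
  proof (cases "Q w = q")
    case True
    let ?c = "cond_pmf P {w'. Q w' = q}"
    have ne: "set_pmf P \<inter> {w'. Q w' = q} \<noteq> {}"
      using w True by auto
    have "pmf (?m w) (u, v, q) = pmf (pair_pmf (map_pmf U ?c) (map_pmf V ?c)) (u, v)"
      using pmf_map_inj'[of "\<lambda>(u, v). (u, v, q)" "pair_pmf (map_pmf U ?c) (map_pmf V ?c)" "(u, v)"]
      by (simp add: True Let_def inj_def)
    also have "\<dots> = ?a * ?b"
      by (simp add: pmf_pair pmf_map measure_cond_pmf[OF ne] Int_def vimage_def conj_commute)
    finally show ?thesis
      using True by simp
  next
    case False
    then show ?thesis
      by (simp add: Let_def) (rule pmf_map_outside, auto)
  qed
  have "pmf (cond_product P U V Q) (u, v, q)
      = measure_pmf.expectation P (\<lambda>w. indicator {w. Q w = q} w * (?a * ?b))"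
    unfolding cond_product_def pmf_bind
    by (rule integral_cong_AE[OF _ _ AE_pmfI[OF eq]]) simp_all
  also have "\<dots> = ?pq * (?a * ?b)"
    by simp
  finally show ?thesis
    by (simp add: field_simps)
qed

text \<open>The expectation is taken first inside each fibre of \<open>Q\<close>, where it is a
  finite bilinear sum; boundedness of \<open>H\<close> justifies the iterated integral.\<close>

lemma expectation_cond_product:
  fixes P :: "'w pmf" and X :: "'w \<Rightarrow> 'x::finite" and Y :: "'w \<Rightarrow> 'y::finite"
    and H :: "'x \<Rightarrow> 'y \<Rightarrow> 'c \<Rightarrow> real"
  assumes bound: "\<And>x y q. \<bar>H x y q\<bar> \<le> B"
  shows "measure_pmf.expectation (cond_product P X Y Q) (\<lambda>(x, y, q). H x y q)
    = measure_pmf.expectation P (\<lambda>w. \<Sum>x\<in>UNIV. \<Sum>y\<in>UNIV.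
        (pmf (map_pmf X (cond_pmf P {w'. Q w' = Q w})) x
          * pmf (map_pmf Y (cond_pmf P {w'. Q w' = Q w})) y) * H x y (Q w))"
proof -
  have pair: "measure_pmf.expectation (pair_pmf r s) (\<lambda>(x, y). h x y)
      = (\<Sum>x\<in>UNIV. \<Sum>y\<in>UNIV. (pmf r x * pmf s y) * h x y)"
      for r s and h :: "'x \<Rightarrow> 'y \<Rightarrow> real"
    by (subst integral_measure_pmf[of UNIV])
      (auto simp: UNIV_Times_UNIV[symmetric] sum.cartesian_product pmf_pair
        simp del: UNIV_Times_UNIV intro!: sum.cong)
  have "measure_pmf.expectation (cond_product P X Y Q) (\<lambda>(x, y, q). H x y q)
    = measure_pmf.expectation P (\<lambda>w. measure_pmf.expectation
        (pair_pmf (map_pmf X (cond_pmf P {w'. Q w' = Q w})) (map_pmf Y (cond_pmf P {w'. Q w' = Q w})))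
        (\<lambda>(x, y). H x y (Q w)))"
    unfolding cond_product_def measure_pmf_bind
    by (subst integral_bind[where K="count_space UNIV" and B'=1 and B=B])
      (auto simp: bound measure_pmf_in_subprob_space case_prod_unfold Let_def)
  then show ?thesis
    by (simp only: pair)
qed

text \<open>\<open>I(U;V|Q)\<close> is the relative entropy of the true law with respect to
  \<open>cond_product\<close>, so the equality case of Gibbs applies.\<close>

lemma cond_mi_zero_imp_law:
  fixes P :: "'w pmf" and U :: "'w \<Rightarrow> 'a::finite" and V :: "'w \<Rightarrow> 'b::finite"
    and Q :: "'w \<Rightarrow> 'c::countable"
  assumes zero: "cond_mi P U V Q = 0"
  shows "map_pmf (\<lambda>w. (U w, V w, Q w)) P = cond_product P U V Q"
proof (rule gibbs_equality)
  let ?r = "map_pmf (\<lambda>w. (U w, V w, Q w)) P" and ?s = "cond_product P U V Q"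
  have s: "pmf ?s (U w, V w, Q w) = prob_at P (\<lambda>w. (U w, Q w)) w * prob_at P (\<lambda>w. (V w, Q w)) w
     / prob_at P Q w" for w
    by (simp add: pmf_cond_product prob_at_eq_prob)
  show "0 < pmf ?s x" if "x \<in> set_pmf ?r" for x
    using that by (auto simp: s prob_at_pos)
  let ?l = "\<lambda>w. log 2 (prob_at P Q w / prob_at P (\<lambda>w. (U w, Q w)) w)
       - log 2 (prob_at P (\<lambda>w. (V w, Q w)) w / prob_at P (\<lambda>w. (U w, V w, Q w)) w)"
  have eq: "log 2 (pmf ?r (U w, V w, Q w) / pmf ?s (U w, V w, Q w)) = ?l w"
    if w: "w \<in> set_pmf P" for w
  proof -
    note pos = prob_at_pos[OF w]
    show ?thesis
      unfolding s using pos[of Q] pos[of "\<lambda>w. (U w, Q w)"] pos[of "\<lambda>w. (V w, Q w)"]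
        pos[of "\<lambda>w. (U w, V w, Q w)"]
      by (simp add: prob_at_def[of P "\<lambda>w. (U w, V w, Q w)", symmetric] log_divide log_mult)
  qed
  have int: "integrable (measure_pmf P) ?l"
    by (intro Bochner_Integration.integrable_diff integrable_cond_entropy)
  then show "integrable (measure_pmf ?r) (\<lambda>x. log 2 (pmf ?r x / pmf ?s x))"
    by (simp, subst integrable_cong_AE) (simp_all add: AE_measure_pmf_iff eq)
  have "measure_pmf.expectation ?r (\<lambda>x. log 2 (pmf ?r x / pmf ?s x))
    = measure_pmf.expectation P ?l"
    by (simp, subst integral_cong_AE) (simp_all add: AE_measure_pmf_iff eq)
  also have "\<dots> = cond_mi P U V Q"
    unfolding cond_mi_eq_cond_entropy cond_entropy_def
    by (rule Bochner_Integration.integral_diff[OF integrable_cond_entropy integrable_cond_entropy])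
  finally show "measure_pmf.expectation ?r (\<lambda>x. log 2 (pmf ?r x / pmf ?s x)) = 0"
    using zero by simp
qed

subsection \<open>Discrepancy\<close>

lemma sum_weighted_le_sum_nonneg_part:
  fixes a R :: "'x \<Rightarrow> real"
  assumes "finite S" "\<And>x. x \<in> S \<Longrightarrow> 0 \<le> a x" "\<And>x. x \<in> S \<Longrightarrow> a x \<le> 1"
  shows "(\<Sum>x\<in>S. a x * R x) \<le> (\<Sum>x\<in>{x\<in>S. 0 \<le> R x}. R x)"
proof -
  have "(\<Sum>x\<in>S. a x * R x) \<le> (\<Sum>x\<in>S. if 0 \<le> R x then R x else 0)"
    using assms by (intro sum_mono) (auto simp: mult_left_le_one_le mult_nonneg_nonpos)
  also have "\<dots> = (\<Sum>x\<in>{x\<in>S. 0 \<le> R x}. R x)"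
    using assms by (simp add: sum.inter_filter)
  finally show ?thesis .
qed

text \<open>A bilinear form on a product of cubes is maximal at vertices, and vertices are
  rectangles. The weights are rounded one side at a time.\<close>

lemma bilinear_le_rectangles:
  fixes M :: "'x::finite \<Rightarrow> 'y::finite \<Rightarrow> real"
  assumes a: "\<And>x. 0 \<le> a x" "\<And>x. a x \<le> 1" and b: "\<And>y. 0 \<le> b y" "\<And>y. b y \<le> 1"
    and rect: "\<And>A B. (\<Sum>x\<in>A. \<Sum>y\<in>B. M x y) \<le> D"
  shows "(\<Sum>x\<in>UNIV. \<Sum>y\<in>UNIV. a x * b y * M x y) \<le> D"
proof -
  \<comment> \<open>\<open>A\<close> is chosen against the still fractional weights
    \<open>b\<close>, then \<open>B\<close> against the fixed set \<open>A\<close>.\<close>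
  define A where "A = {x. 0 \<le> (\<Sum>y\<in>UNIV. b y * M x y)}"
  define B where "B = {y. 0 \<le> (\<Sum>x\<in>A. M x y)}"
  have "(\<Sum>x\<in>UNIV. \<Sum>y\<in>UNIV. a x * b y * M x y) = (\<Sum>x\<in>UNIV. a x * (\<Sum>y\<in>UNIV. b y * M x y))"
    by (simp add: sum_distrib_left mult.assoc)
  also have "\<dots> \<le> (\<Sum>x\<in>A. \<Sum>y\<in>UNIV. b y * M x y)"
    using sum_weighted_le_sum_nonneg_part[of UNIV a] a by (simp add: A_def)
  also have "\<dots> = (\<Sum>y\<in>UNIV. b y * (\<Sum>x\<in>A. M x y))"
    by (subst sum.swap) (simp add: sum_distrib_left)
  also have "\<dots> \<le> (\<Sum>y\<in>B. \<Sum>x\<in>A. M x y)"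
    using sum_weighted_le_sum_nonneg_part[of UNIV b] b by (simp add: B_def)
  also have "\<dots> \<le> D"
    by (subst sum.swap) (rule rect)
  finally show ?thesis .
qed

text \<open>The sign \<sigma> stands in for the absolute value; both signs are wanted because the
  prediction \<open>Z\<close> may be either bit.\<close>

lemma discrepancy_rectangle:
  fixes r :: "('x::finite \<times> 'y::finite) pmf"
  assumes "\<bar>\<sigma>\<bar> = 1"
  shows "(\<Sum>x\<in>A. \<Sum>y\<in>B. \<sigma> * ((if f x y then -1 else 1) * pmf r (x, y))) \<le> discrepancy r f"
proof -
  let ?d = "\<lambda>A B. \<bar>measure_pmf.prob r {(x, y). (x, y) \<in> A \<times> B \<and> \<not> f x y}
           - measure_pmf.prob r {(x, y). (x, y) \<in> A \<times> B \<and> f x y}\<bar>"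
  have prob: "measure_pmf.prob r {(x, y). (x, y) \<in> A \<times> B \<and> g x y}
      = (\<Sum>x\<in>A. \<Sum>y\<in>B. if g x y then pmf r (x, y) else 0)" for g
  proof -
    have "{(x, y). (x, y) \<in> A \<times> B \<and> g x y} = {z \<in> A \<times> B. g (fst z) (snd z)}"
      by auto
    then show ?thesis
      by (simp add: measure_measure_pmf_finite sum.inter_filter sum.cartesian_product
          split_def cong: if_cong)
  qed
  have "(\<Sum>x\<in>A. \<Sum>y\<in>B. \<sigma> * ((if f x y then -1 else 1) * pmf r (x, y)))
    = \<sigma> * (measure_pmf.prob r {(x, y). (x, y) \<in> A \<times> B \<and> \<not> f x y}
           - measure_pmf.prob r {(x, y). (x, y) \<in> A \<times> B \<and> f x y})"
    unfolding prob sum_subtractf[symmetric] sum_distrib_left by (intro sum.cong) auto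
  also have "\<dots> \<le> ?d A B"
    using assms by (simp add: abs_mult abs_le_iff[symmetric] abs_real_def split: if_splits)
  also have "\<dots> \<le> discrepancy r f"
    unfolding discrepancy_def
  proof (rule Max_ge)
    have "{?d A B | A B. True} = range (\<lambda>(A, B). ?d A B)"
      by auto
    then show "finite {?d A B | A B. True}"
      by simp
  qed auto
  finally show ?thesis .
qed

text \<open>Dividing each weight by \<open>s\<close> times its marginal gives weights in the unit
  interval; the two factors \<open>s\<close> come out as a square.\<close>

lemma product_weights_le_discrepancy:
  fixes r :: "('x::finite \<times> 'y::finite) pmf" and pX :: "'x pmf" and pY :: "'y pmf"
  assumes r: "r = pair_pmf pX pY" and \<sigma>: "\<bar>\<sigma>\<bar> = 1" and s: "0 < s"
    and \<alpha>: "\<And>x. 0 \<le> \<alpha> x" "\<And>x. \<alpha> x \<le> s * pmf pX x"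
    and \<beta>: "\<And>y. 0 \<le> \<beta> y" "\<And>y. \<beta> y \<le> s * pmf pY y"
  shows "(\<Sum>x\<in>UNIV. \<Sum>y\<in>UNIV. \<alpha> x * \<beta> y * (\<sigma> * (if f x y then -1 else 1)))
    \<le> s\<^sup>2 * discrepancy r f"
proof -
  let ?a = "\<lambda>x. \<alpha> x / (s * pmf pX x)" and ?b = "\<lambda>y. \<beta> y / (s * pmf pY y)"
  \<comment> \<open>Where the marginal mass is 0, the bound forces the weight to be 0, so division
    by zero does no harm.\<close>
  have a: "\<alpha> x = ?a x * (s * pmf pX x)" for x
    using \<alpha>[of x] s by (cases "pmf pX x = 0") auto
  have b: "\<beta> y = ?b y * (s * pmf pY y)" for y
    using \<beta>[of y] s by (cases "pmf pY y = 0") auto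
  have "(\<Sum>x\<in>UNIV. \<Sum>y\<in>UNIV. \<alpha> x * \<beta> y * (\<sigma> * (if f x y then -1 else 1)))
    = (\<Sum>x\<in>UNIV. \<Sum>y\<in>UNIV. s\<^sup>2 * (?a x * ?b y * (\<sigma> * ((if f x y then -1 else 1) * pmf r (x, y)))))"
  proof (intro sum.cong refl)
    fix x y
    show "\<alpha> x * \<beta> y * (\<sigma> * (if f x y then -1 else 1))
      = s\<^sup>2 * (?a x * ?b y * (\<sigma> * ((if f x y then -1 else 1) * pmf r (x, y))))"
      by (subst a, subst b, simp only: r pmf_pair power2_eq_square mult_ac)
  qed
  also have "\<dots> = s\<^sup>2 * (\<Sum>x\<in>UNIV. \<Sum>y\<in>UNIV. ?a x * ?b y
      * (\<sigma> * ((if f x y then -1 else 1) * pmf r (x, y))))"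
    by (simp only: sum_distrib_left)
  also have "\<dots> \<le> s\<^sup>2 * discrepancy r f"
  proof (intro mult_left_mono bilinear_le_rectangles discrepancy_rectangle \<sigma>)
    show "?a x \<le> 1" for x
      using \<alpha>[of x] s by (cases "pmf pX x = 0") (auto simp: divide_le_eq_1 pmf_pos)
    show "?b y \<le> 1" for y
      using \<beta>[of y] s by (cases "pmf pY y = 0") (auto simp: divide_le_eq_1 pmf_pos)
  qed (use \<alpha> \<beta> s in auto)
  finally show ?thesis .
qed

subsection \<open>Information density\<close>

definition info_density :: "'w pmf \<Rightarrow> ('w \<Rightarrow> 'a) \<Rightarrow> ('w \<Rightarrow> 'b) \<Rightarrow> 'w \<Rightarrow> real" where
  "info_density P A B w = log 2 (prob_at P (\<lambda>w. (A w, B w)) w / (prob_at P A w * prob_at P B w))"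

lemma info_density_eq_diff:
  assumes "w \<in> set_pmf P"
  shows "info_density P A B w
    = log 2 (1 / prob_at P A w) - log 2 (prob_at P B w / prob_at P (\<lambda>w. (A w, B w)) w)"
  using prob_at_pos[OF assms, of A] prob_at_pos[OF assms, of B]
    prob_at_pos[OF assms, of "\<lambda>w. (A w, B w)"]
  by (simp add: info_density_def log_divide log_mult)

lemma integrable_info_density:
  fixes A :: "'w \<Rightarrow> 'a::finite"
  shows "integrable (measure_pmf P) (info_density P A B)"
proof -
  have "integrable (measure_pmf P)
    (\<lambda>w. log 2 (1 / prob_at P A w) - log 2 (prob_at P B w / prob_at P (\<lambda>w. (A w, B w)) w))"
    by (rule Bochner_Integration.integrable_diff[OF _ integrable_cond_entropy])
      (simp add: prob_at_def integrable_finite_range[of P "\<lambda>a. log 2 (1 / pmf (map_pmf A P) a)"])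
  then show ?thesis
    by (subst integrable_cong_AE) (simp_all add: AE_measure_pmf_iff info_density_eq_diff)
qed

text \<open>The density is \<open>- log 2 t\<close>, with \<open>t\<close> the likelihood ratio of
  the product law to the joint law. The mean of \<open>t\<close> is at most 1, so a linear bound on
  \<open>log 2 t\<close> controls the negative part.\<close>

lemma expectation_info_density_ge_positive_part:
  fixes A :: "'w \<Rightarrow> 'a::finite"
  shows "measure_pmf.expectation P (info_density P A B)
    \<ge> measure_pmf.expectation P (\<lambda>w. max 0 (info_density P A B w)) - 3 / 5"
proof -
  let ?s = "pair_pmf (map_pmf A P) (map_pmf B P)"
  let ?C = "\<lambda>w. (A w, B w)"
  let ?t = "\<lambda>w. pmf ?s (?C w) / prob_at P ?C w"
  \<comment> \<open>The best slope in \<open>log 2 t \<le> c * t\<close> is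
    \<open>1 / (exp 1 * ln 2)\<close>, about 0.53; the estimates \<open>exp 1 \<ge> 5/2\<close> and
    \<open>ln 2 \<ge> 2/3\<close> give 3/5.\<close>
  have max_le: "max 0 (- log 2 t) - 3 / 5 * t \<le> - log 2 t" if "0 < t" for t :: real
  proof -
    have "ln (5 / 2) \<le> (1 :: real)"
      using exp_lower_Taylor_quadratic[of 1] ln_le_cancel_iff[of "5 / 2" "exp 1"]
      by (simp add: power2_eq_square)
    then have "ln t \<le> 2 / 5 * t"
      using ln_le_minus_one[of "t / (5 / 2)"] that ln_div[of t "5 / 2"] by simp
    also have "\<dots> \<le> 3 / 5 * t * ln 2"
      using ln2_ge_two_thirds that by simp
    finally have "log 2 t \<le> 3 / 5 * t"
      by (simp add: log_def divide_le_eq)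
    then show ?thesis
      using that by simp
  qed
  have int_t: "integrable (measure_pmf P) ?t"
    by (rule expectation_prob_at_ratio)
  have int_max: "integrable (measure_pmf P) (\<lambda>w. max 0 (info_density P A B w))"
    by (intro Bochner_Integration.integrable_max integrable_info_density) simp
  have "measure_pmf.expectation P (\<lambda>w. max 0 (info_density P A B w)) - 3 / 5
      \<le> measure_pmf.expectation P (\<lambda>w. max 0 (info_density P A B w)) - 3 / 5 * measure_pmf.expectation P ?t"
    using expectation_prob_at_ratio(2)[of P ?s ?C] by simp
  also have "\<dots> = measure_pmf.expectation P (\<lambda>w. max 0 (info_density P A B w) - 3 / 5 * ?t w)"
    by (subst Bochner_Integration.integral_diff[OF int_max integrable_mult_right[OF int_t]])
      (simp only: integral_mult_right_zero)
  also have "\<dots> \<le> measure_pmf.expectation P (info_density P A B)"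
  proof (rule integral_mono_AE)
    show "AE w in measure_pmf P. max 0 (info_density P A B w) - 3 / 5 * ?t w \<le> info_density P A B w"
    proof (rule AE_pmfI)
      fix w assume w: "w \<in> set_pmf P"
      have pos: "0 < ?t w"
        using w by (simp add: pmf_pair prob_at_pos flip: prob_at_def)
      have "info_density P A B w = - log 2 (?t w)"
        using prob_at_pos[OF w, of A] prob_at_pos[OF w, of B] prob_at_pos[OF w, of ?C]
        by (simp add: info_density_def pmf_pair log_divide log_mult flip: prob_at_def)
      with max_le[OF pos] show "max 0 (info_density P A B w) - 3 / 5 * ?t w \<le> info_density P A B w"
        by simp
    qed
  qed (intro Bochner_Integration.integrable_diff integrable_mult_right int_t int_max
      integrable_info_density)+
  finally show ?thesis .
qed

subsection \<open>Tension and advantage\<close>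

lemma common_part_determined:
  fixes P :: "'w pmf"
  assumes law: "map_pmf (\<lambda>w. ((X w, Z w), (Y w, Z w), Q w)) P
      = cond_product P (\<lambda>w. (X w, Z w)) (\<lambda>w. (Y w, Z w)) Q"
    and w: "w \<in> set_pmf P" "w' \<in> set_pmf P" "Q w = Q w'"
  shows "Z w = Z w'"
proof -
  let ?c = "cond_product P (\<lambda>w. (X w, Z w)) (\<lambda>w. (Y w, Z w)) Q"
  \<comment> \<open>Splice \<open>U\<close> from \<open>w\<close> with \<open>V\<close> from
    \<open>w'\<close>. Conditional independence gives the splice positive mass, so it occurs in the
    true law, where both copies of \<open>Z\<close> agree.\<close>
  let ?t = "((X w, Z w), (Y w', Z w'), Q w)"
  have "0 < pmf ?c ?t"
    unfolding pmf_cond_product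
    using w by (intro divide_pos_pos mult_pos_pos measure_pmf_posI[OF w(1)] measure_pmf_posI[OF w(2)])
      simp_all
  then have "?t \<in> set_pmf ?c"
    by (simp add: set_pmf_iff)
  then show ?thesis
    unfolding law[symmetric] by auto
qed

text \<open>Here \<open>a\<close>, \<open>b\<close>, \<open>c\<close> are the probabilities of
  \<open>U\<close>, \<open>V\<close>, \<open>(U,V)\<close>; \<open>d\<close>, \<open>e\<close>,
  \<open>q\<close> those of \<open>(Y,Q)\<close>, \<open>(X,Q)\<close>, \<open>Q\<close>;
  \<open>x\<close>, \<open>y\<close> those of \<open>X\<close>, \<open>Y\<close>. By conditional
  independence \<open>d * e / q\<close> is that of \<open>(U,V,Q)\<close>.\<close>

lemma tension_pointwise:
  fixes a b c d e q x y :: real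
  assumes "0 < a" "0 < b" "0 < c" "0 < d" "0 < e" "0 < q" "0 < x" "0 < y"
  shows "(log 2 (b / c) - log 2 (d / (d * e / q))) + (log 2 (a / c) - log 2 (e / (d * e / q)))
    = log 2 (e / (x * q)) + log 2 (d / (y * q)) + 2 * log 2 (x * y / c) - log 2 (x / a) - log 2 (y / b)"
  using assms by (simp add: log_divide log_mult)

lemma tension_ge_info:
  fixes P :: "'w pmf" and X :: "'w \<Rightarrow> 'x::finite" and Y :: "'w \<Rightarrow> 'y::finite"
    and Z :: "'w \<Rightarrow> bool" and Q :: "'w \<Rightarrow> 'c::countable"
  assumes indep: "map_pmf (\<lambda>w. (X w, Y w)) P = pair_pmf (map_pmf X P) (map_pmf Y P)"
    and law: "map_pmf (\<lambda>w. ((X w, Z w), (Y w, Z w), Q w)) P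
      = cond_product P (\<lambda>w. (X w, Z w)) (\<lambda>w. (Y w, Z w)) Q"
  shows "cond_mi P (\<lambda>w. (X w, Z w)) Q (\<lambda>w. (Y w, Z w))
      + cond_mi P (\<lambda>w. (Y w, Z w)) Q (\<lambda>w. (X w, Z w))
    \<ge> measure_pmf.expectation P (info_density P X Q)
      + measure_pmf.expectation P (info_density P Y Q) - 2"
proof -
  let ?U = "\<lambda>w. (X w, Z w)" and ?V = "\<lambda>w. (Y w, Z w)" and ?XY = "\<lambda>w. (X w, Y w)"
  let ?h = "\<lambda>A B w. log 2 (prob_at P B w / prob_at P (\<lambda>w. (A w, B w)) w)"
  have det: "Z w' = Z w" if "w \<in> set_pmf P" "w' \<in> set_pmf P" "Q w' = Q w" for w w'
    using common_part_determined[OF law] that by blast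
  have pointwise: "(?h ?U ?V w - ?h ?U (\<lambda>w. (Q w, ?V w)) w) + (?h ?V ?U w - ?h ?V (\<lambda>w. (Q w, ?U w)) w)
    = info_density P X Q w + info_density P Y Q w + 2 * ?h Z ?XY w - ?h Z X w - ?h Z Y w"
    if w: "w \<in> set_pmf P" for w
  proof -
    note pos = prob_at_pos[OF w]
    \<comment> \<open>\<open>Q\<close> already fixes \<open>Z\<close> on the support, so adding
      \<open>Z\<close> to the event changes nothing.\<close>
    have UQ: "prob_at P (\<lambda>w. (Q w, ?U w)) w = prob_at P (\<lambda>w. (X w, Q w)) w"
      by (rule prob_at_cong) (auto simp: det[OF w])
    have VQ: "prob_at P (\<lambda>w. (Q w, ?V w)) w = prob_at P (\<lambda>w. (Y w, Q w)) w"
      by (rule prob_at_cong) (auto simp: det[OF w])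
    have XY: "prob_at P ?XY w = prob_at P X w * prob_at P Y w"
      by (simp add: prob_at_def indep pmf_pair)
    have "prob_at P (\<lambda>w. (?U w, ?V w, Q w)) w
        = prob_at P (\<lambda>w. (?U w, Q w)) w * prob_at P (\<lambda>w. (?V w, Q w)) w / prob_at P Q w"
      unfolding prob_at_def[of P "\<lambda>w. (?U w, ?V w, Q w)"] law pmf_cond_product
      by (simp add: prob_at_eq_prob)
    moreover have "prob_at P (\<lambda>w. (?U w, Q w)) w = prob_at P (\<lambda>w. (X w, Q w)) w"
      by (rule prob_at_cong) (auto simp: det[OF w])
    moreover have "prob_at P (\<lambda>w. (?V w, Q w)) w = prob_at P (\<lambda>w. (Y w, Q w)) w"
      by (rule prob_at_cong) (auto simp: det[OF w])
    ultimately have UVQ: "prob_at P (\<lambda>w. (?U w, ?V w, Q w)) w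
        = prob_at P (\<lambda>w. (Y w, Q w)) w * prob_at P (\<lambda>w. (X w, Q w)) w / prob_at P Q w"
      by (simp add: mult.commute)
    have reorder:
      "prob_at P (\<lambda>w. (?U w, Q w, ?V w)) w = prob_at P (\<lambda>w. (?U w, ?V w, Q w)) w"
      "prob_at P (\<lambda>w. (?V w, Q w, ?U w)) w = prob_at P (\<lambda>w. (?U w, ?V w, Q w)) w"
      "prob_at P (\<lambda>w. (?V w, ?U w)) w = prob_at P (\<lambda>w. (?U w, ?V w)) w"
      "prob_at P (\<lambda>w. (Z w, X w, Y w)) w = prob_at P (\<lambda>w. (?U w, ?V w)) w"
      "prob_at P (\<lambda>w. (Z w, X w)) w = prob_at P ?U w"
      "prob_at P (\<lambda>w. (Z w, Y w)) w = prob_at P ?V w"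
      by (rule prob_at_cong, auto)+
    show ?thesis
      unfolding info_density_def reorder UVQ UQ VQ XY
      by (rule tension_pointwise) (rule pos)+
  qed
  have h_nonneg: "0 \<le> ?h Z ?XY w" if w: "w \<in> set_pmf P" for w
  proof -
    have "prob_at P (\<lambda>w. (Z w, ?XY w)) w \<le> prob_at P ?XY w"
      by (rule prob_at_mono) simp
    with prob_at_pos[OF w, of "\<lambda>w. (Z w, ?XY w)"] have "1 \<le> prob_at P ?XY w / prob_at P (\<lambda>w. (Z w, ?XY w)) w"
      by (simp add: le_divide_eq_1_pos)
    then show ?thesis
      by simp
  qed
  note int = integrable_cond_entropy integrable_info_density
    Bochner_Integration.integrable_diff Bochner_Integration.integrable_add
  have "measure_pmf.expectation P (info_density P X Q) + measure_pmf.expectation P (info_density P Y Q)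
      - cond_entropy P Z X - cond_entropy P Z Y
    = measure_pmf.expectation P
        (\<lambda>w. info_density P X Q w + info_density P Y Q w - ?h Z X w - ?h Z Y w)"
    unfolding cond_entropy_def
    by (subst Bochner_Integration.integral_diff, (intro int)+)+
      (subst Bochner_Integration.integral_add, (intro int)+, rule refl)
  also have "\<dots> \<le> measure_pmf.expectation P
    (\<lambda>w. (?h ?U ?V w - ?h ?U (\<lambda>w. (Q w, ?V w)) w) + (?h ?V ?U w - ?h ?V (\<lambda>w. (Q w, ?U w)) w))"
  proof (rule integral_mono_AE)
    show "AE w in measure_pmf P. info_density P X Q w + info_density P Y Q w - ?h Z X w - ?h Z Y w
      \<le> (?h ?U ?V w - ?h ?U (\<lambda>w. (Q w, ?V w)) w) + (?h ?V ?U w - ?h ?V (\<lambda>w. (Q w, ?U w)) w)"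
    proof (rule AE_pmfI)
      fix w assume w: "w \<in> set_pmf P"
      show "info_density P X Q w + info_density P Y Q w - ?h Z X w - ?h Z Y w
        \<le> (?h ?U ?V w - ?h ?U (\<lambda>w. (Q w, ?V w)) w) + (?h ?V ?U w - ?h ?V (\<lambda>w. (Q w, ?U w)) w)"
        \<comment> \<open>The inequality discards the term with expectation
          \<open>2 H(Z|X,Y)\<close>.\<close>
        unfolding pointwise[OF w] using h_nonneg[OF w] by linarith
    qed
  qed (intro int)+
  also have "\<dots> = cond_mi P ?U Q ?V + cond_mi P ?V Q ?U"
    unfolding cond_mi_eq_cond_entropy cond_entropy_def
    by (subst Bochner_Integration.integral_add, (intro int)+,
        (subst Bochner_Integration.integral_diff, (intro int)+)+) (rule refl)
  finally show ?thesis
    \<comment> \<open>\<open>Z\<close> is a bit, so each of the two subtracted entropies is at most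
      1.\<close>
    using cond_entropy_le_log_card[of P Z X] cond_entropy_le_log_card[of P Z Y] by simp
qed

text \<open>Turns the threshold into the domination of the conditional law by a multiple of the
  marginal that \<open>product_weights_le_discrepancy\<close> asks for.\<close>

lemma info_density_le_iff:
  assumes w: "w \<in> set_pmf P"
  shows "info_density P A Q w \<le> \<tau>
    \<longleftrightarrow> pmf (map_pmf A (cond_pmf P {w'. Q w' = Q w})) (A w) \<le> 2 powr \<tau> * prob_at P A w"
proof -
  have ne: "set_pmf P \<inter> {w'. Q w' = Q w} \<noteq> {}"
    using w by auto
  have c: "pmf (map_pmf A (cond_pmf P {w'. Q w' = Q w})) (A w)
      = prob_at P (\<lambda>w. (A w, Q w)) w / prob_at P Q w"
    by (simp add: pmf_map measure_cond_pmf[OF ne] prob_at_eq_prob Int_def vimage_def conj_commute)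
  have "info_density P A Q w \<le> \<tau>
      \<longleftrightarrow> prob_at P (\<lambda>w. (A w, Q w)) w / (prob_at P A w * prob_at P Q w) \<le> 2 powr \<tau>"
    unfolding info_density_def 
    by (subst log_le_iff) (simp_all add: prob_at_pos[OF w])
  then show ?thesis
    unfolding c using prob_at_pos[OF w, of A] prob_at_pos[OF w, of Q]
    by (simp add: field_simps)
qed

text \<open>Given \<open>Q\<close>, the event \<open>G \<tau>\<close> is a rectangle in
  \<open>X\<close> and \<open>Y\<close>, the bit \<open>Z\<close> is constant, and \<open>X\<close>,
  \<open>Y\<close> are independent. The advantage is thus an average of bilinear forms with
  truncated conditional marginals as weights.\<close>

lemma advantage_on_low_info:
  fixes P :: "'w pmf" and X :: "'w \<Rightarrow> 'x::finite" and Y :: "'w \<Rightarrow> 'y::finite"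
    and Z :: "'w \<Rightarrow> bool" and Q :: "'w \<Rightarrow> 'c::countable"
  assumes indep: "map_pmf (\<lambda>w. (X w, Y w)) P = pair_pmf (map_pmf X P) (map_pmf Y P)"
    and law: "map_pmf (\<lambda>w. ((X w, Z w), (Y w, Z w), Q w)) P
      = cond_product P (\<lambda>w. (X w, Z w)) (\<lambda>w. (Y w, Z w)) Q"
  defines "G \<equiv> \<lambda>\<tau>. {w. info_density P X Q w \<le> \<tau> \<and> info_density P Y Q w \<le> \<tau>}"
  shows "measure_pmf.prob P (G \<tau> \<inter> {w. Z w = f (X w) (Y w)})
      - measure_pmf.prob P (G \<tau> \<inter> {w. Z w \<noteq> f (X w) (Y w)})
    \<le> 2 powr (2 * \<tau>) * discrepancy (map_pmf (\<lambda>w. (X w, Y w)) P) f"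
proof -
  let ?s = "2 powr \<tau>" and ?r = "map_pmf (\<lambda>w. (X w, Y w)) P"
  define z where "z q = (\<exists>w\<in>set_pmf P. Q w = q \<and> Z w)" for q
  have z: "z (Q w) = Z w" if "w \<in> set_pmf P" for w
    unfolding z_def using common_part_determined[OF law] that by blast
  let ?cX = "\<lambda>q. pmf (map_pmf X (cond_pmf P {w'. Q w' = q}))"
  let ?cY = "\<lambda>q. pmf (map_pmf Y (cond_pmf P {w'. Q w' = q}))"
  \<comment> \<open>\<open>a\<close> and \<open>b\<close> are the two sides of the rectangle over
    \<open>q\<close>; \<open>sg\<close> is 1 when the bit determined by \<open>q\<close> predicts
    \<open>f\<close> correctly and -1 otherwise.\<close>
  define a where "a q x = (if ?cX q x \<le> ?s * pmf (map_pmf X P) x then 1 else 0 :: real)" for q x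
  define b where "b q y = (if ?cY q y \<le> ?s * pmf (map_pmf Y P) y then 1 else 0 :: real)" for q y
  define sg where "sg x y q = (if z q then -1 else 1) * (if f x y then -1 else 1 :: real)" for x y q
  let ?H = "\<lambda>x y q. a q x * b q y * sg x y q"
  have law': "map_pmf (\<lambda>w. (X w, Y w, Q w)) P = cond_product P X Y Q"
    using arg_cong[OF law, of "map_pmf (\<lambda>(u, v, q). (fst u, fst v, q))"]
    by (simp add: map_cond_product pmf.map_comp comp_def)
  have H_bound: "\<bar>?H x y q\<bar> \<le> 1" for x y q
    by (simp add: a_def b_def sg_def)
  let ?E = "{w. Z w = f (X w) (Y w)}"
  have "measure_pmf.prob P (G \<tau> \<inter> ?E) - measure_pmf.prob P (G \<tau> \<inter> - ?E)
    = measure_pmf.expectation P (\<lambda>w. indicator (G \<tau> \<inter> ?E) w - indicator (G \<tau> \<inter> - ?E) w)"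
    by (subst Bochner_Integration.integral_diff)
      (auto intro!: measure_pmf.integrable_const_bound[where B=1])
  also have "\<dots> = measure_pmf.expectation P (\<lambda>w. ?H (X w) (Y w) (Q w))"
  proof (rule integral_cong_AE)
    show "AE w in measure_pmf P. indicator (G \<tau> \<inter> ?E) w - indicator (G \<tau> \<inter> - ?E) w
        = ?H (X w) (Y w) (Q w)"
    proof (rule AE_pmfI)
      fix w assume w: "w \<in> set_pmf P"
      show "indicator (G \<tau> \<inter> ?E) w - indicator (G \<tau> \<inter> - ?E) w = ?H (X w) (Y w) (Q w)"
        unfolding a_def b_def sg_def z[OF w] G_def
        using info_density_le_iff[OF w, of X Q \<tau>] info_density_le_iff[OF w, of Y Q \<tau>]
        by (auto simp: indicator_def prob_at_def)
    qed
  qed simp_all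
  also have "\<dots> = measure_pmf.expectation (cond_product P X Y Q) (\<lambda>(x, y, q). ?H x y q)"
    by (simp add: law'[symmetric])
  also have "\<dots> = measure_pmf.expectation P (\<lambda>w. \<Sum>x\<in>UNIV. \<Sum>y\<in>UNIV.
      (?cX (Q w) x * ?cY (Q w) y) * ?H x y (Q w))"
    by (rule expectation_cond_product[OF H_bound])
  also have "\<dots> \<le> measure_pmf.expectation P (\<lambda>w. ?s\<^sup>2 * discrepancy ?r f)"
  proof (rule integral_mono')
    fix w
    have "(\<Sum>x\<in>UNIV. \<Sum>y\<in>UNIV. (?cX (Q w) x * ?cY (Q w) y) * ?H x y (Q w))
      = (\<Sum>x\<in>UNIV. \<Sum>y\<in>UNIV. (a (Q w) x * ?cX (Q w) x) * (b (Q w) y * ?cY (Q w) y)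
          * ((if z (Q w) then -1 else 1) * (if f x y then -1 else 1)))"
      by (intro sum.cong refl) (simp only: sg_def mult_ac)
    also have "\<dots> \<le> ?s\<^sup>2 * discrepancy ?r f"
      by (rule product_weights_le_discrepancy[OF indep]) (auto simp: a_def b_def)
    finally show "(\<Sum>x\<in>UNIV. \<Sum>y\<in>UNIV. (?cX (Q w) x * ?cY (Q w) y) * ?H x y (Q w))
        \<le> ?s\<^sup>2 * discrepancy ?r f" .
  next
    \<comment> \<open>The empty rectangle shows that the discrepancy is nonnegative.\<close>
    show "0 \<le> ?s\<^sup>2 * discrepancy ?r f"
      using discrepancy_rectangle[where \<sigma>=1 and A="{}" and B="{}" and f=f and r="?r"] by simp
  qed simp_all
  also have "\<dots> = 2 powr (2 * \<tau>) * discrepancy ?r f"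
    by (simp add: power2_eq_square flip: powr_add)
  finally show ?thesis
    by (simp only: Collect_neg_eq)
qed

text \<open>On the low-information event, total mass is advantage plus twice the error mass, hence
  at most \<open>2 powr (2 * \<tau>) * \<Delta> + 1 - 2 * \<epsilon>\<close>; take the
  complement.\<close>

lemma prob_high_info_ge:
  fixes P :: "'w pmf" and X :: "'w \<Rightarrow> 'x::finite" and Y :: "'w \<Rightarrow> 'y::finite"
    and Z :: "'w \<Rightarrow> bool" and Q :: "'w \<Rightarrow> 'c::countable"
  assumes indep: "map_pmf (\<lambda>w. (X w, Y w)) P = pair_pmf (map_pmf X P) (map_pmf Y P)"
    and law: "map_pmf (\<lambda>w. ((X w, Z w), (Y w, Z w), Q w)) P
      = cond_product P (\<lambda>w. (X w, Z w)) (\<lambda>w. (Y w, Z w)) Q"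
    and disc: "discrepancy (map_pmf (\<lambda>w. (X w, Y w)) P) f \<le> \<Delta>"
    and err: "measure_pmf.prob P {w. Z w \<noteq> f (X w) (Y w)} \<le> 1 / 2 - \<epsilon>"
  shows "2 * \<epsilon> - 2 powr (2 * \<tau>) * \<Delta>
    \<le> measure_pmf.prob P {w. \<tau> < max (info_density P X Q w) (info_density P Y Q w)}"
proof -
  let ?G = "{w. info_density P X Q w \<le> \<tau> \<and> info_density P Y Q w \<le> \<tau>}"
  let ?E = "{w. Z w = f (X w) (Y w)}" and ?N = "{w. Z w \<noteq> f (X w) (Y w)}"
  have "measure_pmf.prob P (?G \<inter> ?E) - measure_pmf.prob P (?G \<inter> ?N) \<le> 2 powr (2 * \<tau>) * \<Delta>"
    by (rule order_trans[OF advantage_on_low_info[OF indep law] mult_left_mono[OF disc]]) simp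
  moreover have "measure_pmf.prob P ?G = measure_pmf.prob P (?G \<inter> ?E) + measure_pmf.prob P (?G \<inter> ?N)"
    by (subst measure_pmf.finite_measure_Union[symmetric]) (auto intro!: arg_cong[where f="measure_pmf.prob P"])
  moreover have "measure_pmf.prob P (?G \<inter> ?N) \<le> measure_pmf.prob P ?N"
    by (rule measure_pmf.finite_measure_mono) auto
  moreover have "{w. \<tau> < max (info_density P X Q w) (info_density P Y Q w)} = UNIV - ?G"
    by auto
  ultimately show ?thesis
    using err measure_pmf.prob_compl[of ?G P] by (simp add: algebra_simps)
qed

section \<open>Summation over information thresholds\<close>

lemma count_thresholds_le:
  assumes "0 \<le> (m :: real)"
  shows "(\<Sum>k=1..n. if real k / 4 < m then 1 else 0 :: real) \<le> 4 * m"
proof -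
  have "(\<Sum>k=1..n. if real k / 4 < m then 1 else 0 :: real) = card {k \<in> {1..n}. real k / 4 < m}"
    by (simp add: sum.inter_filter[symmetric])
  also have "\<dots> \<le> card {1..nat \<lfloor>4 * m\<rfloor>}"
    by (intro of_nat_mono card_mono) (auto simp: le_nat_floor)
  also have "\<dots> \<le> 4 * m"
    using assms by simp
  finally show ?thesis .
qed

text \<open>A geometric sum of ratio \<open>sqrt 2\<close> is at most \<open>2 + sqrt 2\<close>
  times its last term. With 7/2 instead, the induction step amounts to
  \<open>7/5 \<le> sqrt 2\<close>.\<close>

lemma sum_sqrt2_powers_le: "(\<Sum>k=1..n. 2 powr (real k / 2)) \<le> 7 / 2 * 2 powr (real n / 2)"
proof (induction n)
  case 0
  show ?case by simp
next
  case (Suc n)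
  have q: "2 powr (real (Suc n) / 2) = 2 powr (real n / 2) * sqrt 2"
    by (simp add: powr_half_sqrt[symmetric] add_divide_distrib add.commute flip: powr_add)
  have "7 / 5 \<le> sqrt 2"
    by (rule real_le_rsqrt) (simp add: power2_eq_square)
  then have "7 / 2 * 2 powr (real n / 2) \<le> 5 / 2 * (2 powr (real n / 2) * sqrt 2)"
    by (simp add: mult_left_mono)
  moreover have "(\<Sum>k=1..Suc n. 2 powr (real k / 2))
      = (\<Sum>k=1..n. 2 powr (real k / 2)) + 2 powr (real n / 2) * sqrt 2"
    unfolding q[symmetric] by simp
  ultimately show ?case
    using Suc.IH unfolding q by linarith
qed

text \<open>A discrete layer-cake formula: the number of thresholds \<open>k/4\<close> below the
  larger density is at most four times the sum of the positive parts, and each threshold is passed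
  with the probability bounded in \<open>prob_high_info_ge\<close>.\<close>

lemma expectation_positive_info_ge:
  fixes P :: "'w pmf" and X :: "'w \<Rightarrow> 'x::finite" and Y :: "'w \<Rightarrow> 'y::finite"
    and Z :: "'w \<Rightarrow> bool" and Q :: "'w \<Rightarrow> 'c::countable"
  assumes indep: "map_pmf (\<lambda>w. (X w, Y w)) P = pair_pmf (map_pmf X P) (map_pmf Y P)"
    and law: "map_pmf (\<lambda>w. ((X w, Z w), (Y w, Z w), Q w)) P
      = cond_product P (\<lambda>w. (X w, Z w)) (\<lambda>w. (Y w, Z w)) Q"
    and disc: "discrepancy (map_pmf (\<lambda>w. (X w, Y w)) P) f \<le> \<Delta>" and \<Delta>: "0 < \<Delta>"
    and err: "measure_pmf.prob P {w. Z w \<noteq> f (X w) (Y w)} \<le> 1 / 2 - \<epsilon>"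
    and \<epsilon>: "0 < \<epsilon>" and L: "0 \<le> log 2 (\<epsilon> / \<Delta>)"
  shows "\<epsilon> * log 2 (\<epsilon> / \<Delta>) - 5 / 4 * \<epsilon>
    \<le> measure_pmf.expectation P (\<lambda>w. max 0 (info_density P X Q w))
      + measure_pmf.expectation P (\<lambda>w. max 0 (info_density P Y Q w))"
proof -
  \<comment> \<open>The last \<open>k\<close> for which the bound
    \<open>2 * \<epsilon> - 2 powr (k/2) * \<Delta>\<close> is still nonnegative.\<close>
  define n where "n = nat \<lfloor>2 * log 2 (2 * \<epsilon> / \<Delta>)\<rfloor>"
  let ?m = "\<lambda>w. max (info_density P X Q w) (info_density P Y Q w)"
  have L2: "log 2 (2 * \<epsilon> / \<Delta>) = log 2 (\<epsilon> / \<Delta>) + 1"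
    using \<epsilon> \<Delta> by (simp add: log_divide log_mult)
  have n_upper: "real n \<le> 2 * log 2 (2 * \<epsilon> / \<Delta>)" and n_lower: "2 * log 2 (2 * \<epsilon> / \<Delta>) - 1 \<le> real n"
    using L real_of_int_floor_add_one_ge[of "2 * log 2 (2 * \<epsilon> / \<Delta>)"]
    unfolding n_def L2 by auto
  have "2 powr (real n / 2) \<le> 2 powr log 2 (2 * \<epsilon> / \<Delta>)"
    using n_upper by (intro powr_mono) auto
  also have "\<dots> = 2 * \<epsilon> / \<Delta>"
    using \<epsilon> \<Delta> by (intro powr_log_cancel) auto
  finally have n_powr: "2 powr (real n / 2) * \<Delta> \<le> 2 * \<epsilon>"
    using \<Delta> by (simp add: field_simps)
  \<comment> \<open>The 2 inside the logarithm gains \<open>4 * \<epsilon>\<close>, rounding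
    \<open>n\<close> down costs \<open>2 * \<epsilon>\<close> and the geometric sum
    \<open>7 * \<epsilon>\<close>: a net loss of \<open>5 * \<epsilon>\<close>, divided by 4 for the
    spacing.\<close>
  have "4 * (\<epsilon> * log 2 (\<epsilon> / \<Delta>) - 5 / 4 * \<epsilon>) = 2 * \<epsilon> * (2 * log 2 (2 * \<epsilon> / \<Delta>) - 1) - 7 / 2 * (2 * \<epsilon>)"
    unfolding L2 by (simp add: algebra_simps)
  also have "\<dots> \<le> 2 * \<epsilon> * real n - 7 / 2 * (2 powr (real n / 2) * \<Delta>)"
    using n_powr n_lower \<epsilon> by (intro diff_mono mult_left_mono) auto
  also have "\<dots> \<le> 2 * \<epsilon> * real n - (\<Sum>k=1..n. 2 powr (real k / 2)) * \<Delta>"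
    using mult_right_mono[OF sum_sqrt2_powers_le[of n], of \<Delta>] \<Delta> by simp
  also have "\<dots> = (\<Sum>k=1..n. 2 * \<epsilon> - 2 powr (2 * (real k / 4)) * \<Delta>)"
    by (simp add: sum_subtractf sum_distrib_right)
  also have "\<dots> \<le> (\<Sum>k=1..n. measure_pmf.prob P {w. real k / 4 < ?m w})"
    by (intro sum_mono prob_high_info_ge[OF indep law disc err])
  also have "\<dots> = measure_pmf.expectation P (\<lambda>w. \<Sum>k=1..n. indicator {w. real k / 4 < ?m w} w)"
    by (subst Bochner_Integration.integral_sum) (auto intro!: measure_pmf.integrable_const_bound[where B=1])
  also have "\<dots> \<le> measure_pmf.expectation P
      (\<lambda>w. 4 * (max 0 (info_density P X Q w) + max 0 (info_density P Y Q w)))"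
  proof (rule integral_mono)
    show "integrable (measure_pmf P)
        (\<lambda>w. 4 * (max 0 (info_density P X Q w) + max 0 (info_density P Y Q w)))"
      by (intro integrable_mult_right Bochner_Integration.integrable_add
          Bochner_Integration.integrable_max integrable_info_density) simp_all
    fix w
    let ?p = "max 0 (info_density P X Q w) + max 0 (info_density P Y Q w)"
    have "(\<Sum>k=1..n. indicator {w. real k / 4 < ?m w} w) \<le> (\<Sum>k=1..n. if real k / 4 < ?p then 1 else 0 :: real)"
      by (intro sum_mono) (auto simp: indicator_def)
    also have "\<dots> \<le> 4 * ?p"
      by (rule count_thresholds_le) simp
    finally show "(\<Sum>k=1..n. indicator {w. real k / 4 < ?m w} w) \<le> 4 * ?p" .
  qed (auto intro!: Bochner_Integration.integrable_sum measure_pmf.integrable_const_bound[where B=1])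
  also have "\<dots> = 4 * (measure_pmf.expectation P (\<lambda>w. max 0 (info_density P X Q w))
      + measure_pmf.expectation P (\<lambda>w. max 0 (info_density P Y Q w)))"
    by (subst integral_mult_right_zero, subst Bochner_Integration.integral_add)
      (auto intro!: Bochner_Integration.integrable_max integrable_info_density)
  finally show ?thesis
    by simp
qed

lemma tension_lower_bound:
  fixes P :: "'w pmf" and X :: "'w \<Rightarrow> 'x::finite" and Y :: "'w \<Rightarrow> 'y::finite"
    and Z :: "'w \<Rightarrow> bool" and Q :: "'w \<Rightarrow> 'c::countable"
  assumes indep: "map_pmf (\<lambda>w. (X w, Y w)) P = pair_pmf (map_pmf X P) (map_pmf Y P)"
    and disc: "discrepancy (map_pmf (\<lambda>w. (X w, Y w)) P) f \<le> \<Delta>" and \<Delta>: "0 < \<Delta>"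
    and err: "measure_pmf.prob P {w. Z w \<noteq> f (X w) (Y w)} \<le> 1 / 2 - \<epsilon>"
    and \<epsilon>: "0 < \<epsilon>"
    and zero: "cond_mi P (\<lambda>w. (X w, Z w)) (\<lambda>w. (Y w, Z w)) Q = 0"
  shows "\<epsilon> / (2 * (1 - \<epsilon>)) * log 2 (\<epsilon> / \<Delta>) - 4
    \<le> cond_mi P (\<lambda>w. (X w, Z w)) Q (\<lambda>w. (Y w, Z w))
      + cond_mi P (\<lambda>w. (Y w, Z w)) Q (\<lambda>w. (X w, Z w))"
proof -
  let ?L = "log 2 (\<epsilon> / \<Delta>)"
  let ?EX = "measure_pmf.expectation P (\<lambda>w. max 0 (info_density P X Q w))"
  let ?EY = "measure_pmf.expectation P (\<lambda>w. max 0 (info_density P Y Q w))"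
  note law = cond_mi_zero_imp_law[OF zero]
  have "0 \<le> measure_pmf.prob P {w. Z w \<noteq> f (X w) (Y w)}"
    by simp
  with err have half: "\<epsilon> \<le> 1 / 2"
    by linarith
  \<comment> \<open>Since \<epsilon> is at most 1/2, the loss \<open>5/4 * \<epsilon>\<close> is
    below 4/5. Adding 3/5 for each negative part and 2 for the entropies of \<open>Z\<close> gives
    the constant 4.\<close>
  have "\<epsilon> / (2 * (1 - \<epsilon>)) * ?L - 4 / 5 \<le> ?EX + ?EY"
  proof (cases "0 \<le> ?L")
    case True
    have "\<epsilon> / (2 * (1 - \<epsilon>)) \<le> \<epsilon>"
      using half \<epsilon> by (simp add: divide_le_eq)
    then have "\<epsilon> / (2 * (1 - \<epsilon>)) * ?L \<le> \<epsilon> * ?L"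
      using True by (rule mult_right_mono)
    with expectation_positive_info_ge[OF indep law disc \<Delta> err \<epsilon> True] half show ?thesis
      by linarith
  next
    \<comment> \<open>A negative logarithm makes the main term nonpositive, and the positive parts
      bound it trivially.\<close>
    case False
    have "\<epsilon> / (2 * (1 - \<epsilon>)) * ?L \<le> 0"
      using False half \<epsilon> by (intro mult_nonneg_nonpos) auto
    moreover have "0 \<le> ?EX" "0 \<le> ?EY"
      by simp_all
    ultimately show ?thesis
      by linarith
  qed
  with tension_ge_info[OF indep law] expectation_info_density_ge_positive_part[of P X Q]
    expectation_info_density_ge_positive_part[of P Y Q]
  show ?thesis
    by linarith
qed

section \<open>Transfer to the extended law\<close>

lemma prob_at_AE_cong:
  assumes "\<And>w. w \<in> set_pmf P \<Longrightarrow> A w = A' w" "w \<in> set_pmf P"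
  shows "prob_at P A w = prob_at P A' w"
proof -
  have "map_pmf A P = map_pmf A' P"
    using assms(1) by (intro map_pmf_cong refl)
  then show ?thesis
    using assms by (simp add: prob_at_def)
qed

lemma cond_entropy_cong:
  assumes "\<And>w. w \<in> set_pmf P \<Longrightarrow> A w = A' w" "\<And>w. w \<in> set_pmf P \<Longrightarrow> B w = B' w"
  shows "cond_entropy P A B = cond_entropy P A' B'"
proof -
  have "prob_at P B w = prob_at P B' w"
    "prob_at P (\<lambda>w. (A w, B w)) w = prob_at P (\<lambda>w. (A' w, B' w)) w" if "w \<in> set_pmf P" for w
    by (rule prob_at_AE_cong; simp add: assms that)+
  then show ?thesis
    unfolding cond_entropy_def by (intro integral_cong_AE AE_pmfI) auto
qed

text \<open>In the law of triples the two copies of \<open>Z\<close> agree only on the support, so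
  rewriting \<open>V\<close> with the copy taken from \<open>U\<close> is valid only almost
  surely.\<close>

lemma cond_mi_cong:
  assumes "\<And>w. w \<in> set_pmf P \<Longrightarrow> A w = A' w" "\<And>w. w \<in> set_pmf P \<Longrightarrow> B w = B' w"
    "\<And>w. w \<in> set_pmf P \<Longrightarrow> C w = C' w"
  shows "cond_mi P A B C = cond_mi P A' B' C'"
proof -
  have "cond_entropy P A C = cond_entropy P A' C'"
    by (rule cond_entropy_cong) (simp_all only: assms)
  moreover have "cond_entropy P A (\<lambda>w. (B w, C w)) = cond_entropy P A' (\<lambda>w. (B' w, C' w))"
    by (rule cond_entropy_cong) (simp_all only: assms)
  ultimately show ?thesis
    by (simp only: cond_mi_eq_cond_entropy)
qed

lemma cond_entropy_eq_0_if_determined: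
  assumes "\<And>w w'. w \<in> set_pmf P \<Longrightarrow> w' \<in> set_pmf P \<Longrightarrow> B w' = B w \<Longrightarrow> A w' = A w"
  shows "cond_entropy P A B = 0"
proof -
  have "log 2 (prob_at P B w / prob_at P (\<lambda>w. (A w, B w)) w) = 0" if w: "w \<in> set_pmf P" for w
  proof -
    have "prob_at P (\<lambda>w. (A w, B w)) w = prob_at P B w"
      by (rule prob_at_cong) (auto intro: assms[OF w])
    then show ?thesis
      using prob_at_pos[OF w, of B] by simp
  qed
  then have "cond_entropy P A B = measure_pmf.expectation P (\<lambda>_. 0)"
    unfolding cond_entropy_def by (intro integral_cong_AE AE_pmfI) auto
  then show ?thesis
    by simp
qed

lemma cond_mi_eq_0_if_determined:
  assumes "\<And>w w'. w \<in> set_pmf P \<Longrightarrow> w' \<in> set_pmf P \<Longrightarrow> Q w' = Q w \<Longrightarrow> U w' = U w"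
  shows "cond_mi P U V Q = 0"
proof -
  have "cond_entropy P U Q = 0" "cond_entropy P U (\<lambda>w. (V w, Q w)) = 0"
    by (rule cond_entropy_eq_0_if_determined, use assms in blast)+
  then show ?thesis
    by (simp add: cond_mi_eq_cond_entropy)
qed

lemma map_extend_law: "map_pmf (\<lambda>(u, v, q). (u, v)) (extend_law r K) = r"
proof -
  have "map_pmf (\<lambda>(u, v, q). (u, v)) (extend_law r K) = bind_pmf r return_pmf"
    unfolding extend_law_def map_bind_pmf
    by (intro bind_pmf_cong refl) (auto simp: pmf.map_comp comp_def)
  then show ?thesis
    by (simp only: bind_return_pmf')
qed

theorem theorem3:
  fixes p :: "'w pmf"
    and X :: "'w \<Rightarrow> 'x::finite" and Y :: "'w \<Rightarrow> 'y::finite" and Z :: "'w \<Rightarrow> bool"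
    and f :: "'x \<Rightarrow> 'y \<Rightarrow> bool" and \<Delta> \<epsilon> :: real
  assumes indep: "map_pmf (\<lambda>\<omega>. (X \<omega>, Y \<omega>)) p = pair_pmf (map_pmf X p) (map_pmf Y p)"
    and disc: "discrepancy (map_pmf (\<lambda>\<omega>. (X \<omega>, Y \<omega>)) p) f \<le> \<Delta>"
    and Delta_pos: "\<Delta> > 0"
    and err: "measure_pmf.prob p {\<omega>. Z \<omega> \<noteq> f (X \<omega>) (Y \<omega>)} \<le> 1 / 2 - \<epsilon>"
    and eps_pos: "\<epsilon> > 0"
  shows "wyner_tension (map_pmf (\<lambda>\<omega>. ((X \<omega>, Z \<omega>), (Y \<omega>, Z \<omega>))) p)
           \<ge> \<epsilon> / (2 * (1 - \<epsilon>)) * log 2 (\<epsilon> / \<Delta>) - 4"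
proof -
  let ?r = "map_pmf (\<lambda>\<omega>. ((X \<omega>, Z \<omega>), (Y \<omega>, Z \<omega>))) p"
  let ?U = "\<lambda>(u :: 'x \<times> bool, v :: 'y \<times> bool, q :: nat). u"
  let ?V = "\<lambda>(u :: 'x \<times> bool, v :: 'y \<times> bool, q :: nat). v"
  let ?Q = "\<lambda>(u :: 'x \<times> bool, v :: 'y \<times> bool, q :: nat). q"
  let ?S = "{cond_mi (extend_law ?r K) ?U ?Q ?V + cond_mi (extend_law ?r K) ?V ?Q ?U | K.
              cond_mi (extend_law ?r K) ?U ?V ?Q = 0}"
  \<comment> \<open>Letting \<open>Q\<close> encode \<open>(U, V)\<close> shows that the infimum
    ranges over a nonempty set, as a lower bound on a real infimum requires.\<close>
  have "cond_mi (extend_law ?r (\<lambda>uv. return_pmf (to_nat uv))) ?U ?V ?Q = 0"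
    by (rule cond_mi_eq_0_if_determined) (auto simp: extend_law_def)
  then have "?S \<noteq> {}"
    by blast
  moreover have "\<epsilon> / (2 * (1 - \<epsilon>)) * log 2 (\<epsilon> / \<Delta>) - 4
      \<le> cond_mi (extend_law ?r K) ?U ?Q ?V + cond_mi (extend_law ?r K) ?V ?Q ?U"
    if zero: "cond_mi (extend_law ?r K) ?U ?V ?Q = 0" for K
  proof -
    let ?P = "extend_law ?r K"
    let ?X = "\<lambda>w. fst (?U w)" and ?Y = "\<lambda>w. fst (?V w)" and ?Z = "\<lambda>w. snd (?U w)"
    \<comment> \<open>The extension does not disturb the joint law of \<open>X\<close>,
      \<open>Y\<close>, \<open>Z\<close>, so independence, discrepancy and error probability carry
      over from \<open>p\<close>.\<close>
    have push: "map_pmf (\<lambda>w. g (?X w) (?Y w) (?Z w)) ?P = map_pmf (\<lambda>\<omega>. g (X \<omega>) (Y \<omega>) (Z \<omega>)) p"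
      for g :: "'x \<Rightarrow> 'y \<Rightarrow> bool \<Rightarrow> 'g"
      using arg_cong[OF map_extend_law[of ?r K], of "map_pmf (\<lambda>(u, v). g (fst u) (fst v) (snd u))"]
      by (simp add: pmf.map_comp comp_def case_prod_unfold)
    have eq: "?V w = (?Y w, ?Z w)" "?U w = (?X w, ?Z w)" if "w \<in> set_pmf ?P" for w
      using that by (auto simp: extend_law_def)
    have cong: "cond_mi ?P ?U ?V ?Q = cond_mi ?P (\<lambda>w. (?X w, ?Z w)) (\<lambda>w. (?Y w, ?Z w)) ?Q"
      "cond_mi ?P ?U ?Q ?V = cond_mi ?P (\<lambda>w. (?X w, ?Z w)) ?Q (\<lambda>w. (?Y w, ?Z w))"
      "cond_mi ?P ?V ?Q ?U = cond_mi ?P (\<lambda>w. (?Y w, ?Z w)) ?Q (\<lambda>w. (?X w, ?Z w))"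
      by (rule cond_mi_cong, (rule eq refl, assumption?)+)+
    show ?thesis
      unfolding cong
    proof (rule tension_lower_bound[OF _ _ Delta_pos _ eps_pos])
      show "map_pmf (\<lambda>w. (?X w, ?Y w)) ?P = pair_pmf (map_pmf ?X ?P) (map_pmf ?Y ?P)"
        using indep push[of "\<lambda>x y z. (x, y)"] push[of "\<lambda>x y z. x"] push[of "\<lambda>x y z. y"] by simp
      show "discrepancy (map_pmf (\<lambda>w. (?X w, ?Y w)) ?P) f \<le> \<Delta>"
        using disc push[of "\<lambda>x y z. (x, y)"] by simp
      have "measure_pmf.prob ?P {w. ?Z w \<noteq> f (?X w) (?Y w)}
          = measure_pmf.prob p {\<omega>. Z \<omega> \<noteq> f (X \<omega>) (Y \<omega>)}"
        \<comment> \<open>The error probability is the mass at \<open>True\<close> of the Boolean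
          variable that records an error.\<close>
        using arg_cong[OF push[of "\<lambda>x y z. z \<noteq> f x y"], of "\<lambda>r. pmf r True"]
        by (simp add: pmf_map vimage_def)
      with err show "measure_pmf.prob ?P {w. ?Z w \<noteq> f (?X w) (?Y w)} \<le> 1 / 2 - \<epsilon>"
        by simp
      show "cond_mi ?P (\<lambda>w. (?X w, ?Z w)) (\<lambda>w. (?Y w, ?Z w)) ?Q = 0"
        using zero unfolding cong .
    qed
  qed
  ultimately show ?thesis
    unfolding wyner_tension_def Let_def by (intro cInf_greatest) blast+
qed

end
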